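(* Let $r\ge 1$ be an integer, $k_1,\dots,k_r$ integers, and $a,b,c$ positive real numbers. Then for every integer $n\ge 0$, $$E^{(k_1,\dots,k_r)}_n(x;a,b,c)=\sum_{m=0}^{\infty}\sum_{l=m}^{n}(r\ln c)^l\left\{ l \atop m\right\}\binom{n}{l}E^{(k_1,\dots,k_r)}_{n-l}(-m\ln c;a,b)\,(x)^{(m)}.$$
   Context: The multiple polylogarithm is the formal power series $\mathrm{Li}_{(k_1,\dots,k_r)}(z)=\sum_{0<m_1<m_2<\dots<m_r}\frac{z^{m_r}}{m_1^{k_1}m_2^{k_2}\cdots m_r^{k_r}}$. For $u>0$ write $u^{t}=e^{t\ln u}$. The generalized multi poly-Euler polynomials $E^{(k_1,\dots,k_r)}_n(x;a,b,c)$ are defined by the generating function (formal power series in $t$) $$\frac{2\,\mathrm{Li}_{(k_1,\dots,k_r)}(1-(ab)^{-t})}{(a^{-t}+b^{t})^r}\,c^{rxt}=\sum_{n=0}^{\infty}E^{(k_1,\dots,k_r)}_n(x;a,b,c)\frac{t^n}{n!},$$ and $E^{(k_1,\dots,k_r)}_n(x;a,b):=E^{(k_1,\dots,k_r)}_n(x;a,b,e)$, i.e. the case where $c^{rxt}$ is replaced by $e^{rxt}$. $\left\{ l \atop m\right\}$ denotes the Stirling numbers of the second kind, and $(x)^{(m)}=x(x+1)\cdots(x+m-1)$ is the rising factorial, $(x)^{(0)}=1$. *)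

theory Defs
  imports
    Complex_Main
    "HOL-Computational_Algebra.Formal_Power_Series"
    "HOL-Combinatorics.Stirling"
begin

text \<open>The index list \<^term>\<open>ks\<close> is $(k_1,\dots,k_r)$ with $r = $ \<^term>\<open>length ks\<close> $\geq 1$.
  The coefficient of $z^n$ in $\mathrm{Li}_{(k_1,\dots,k_r)}(z)$ is the sum of
  $1/(m_1^{k_1}\cdots m_r^{k_r})$ over $0 < m_1 < \dots < m_r = n$.\<close>

definition polylog_indices :: "nat \<Rightarrow> nat \<Rightarrow> nat list set" where
  "polylog_indices r n =
     {ms. length ms = r \<and> sorted_wrt (<) ms \<and> (\<forall>m\<in>set ms. 0 < m) \<and> last ms = n}"

lemma finite_polylog_indices:
  assumes "r \<ge> 1"
  shows "finite (polylog_indices r n)"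
proof (rule finite_subset)
  show "polylog_indices r n \<subseteq> {ms. set ms \<subseteq> {..n} \<and> length ms = r}"
  proof
    fix ms assume *: "ms \<in> polylog_indices r n"
    have "m \<le> last ms" if "m \<in> set ms" for m
      using * that by (induction ms rule: rev_induct)
        (auto simp: polylog_indices_def sorted_wrt_append)
    with * show "ms \<in> {ms. set ms \<subseteq> {..n} \<and> length ms = r}"
      by (auto simp: polylog_indices_def)
  qed
  show "finite {ms. set ms \<subseteq> {..n} \<and> length ms = r}"
    by (rule finite_lists_length_eq) simp
qed

definition multi_polylog :: "int list \<Rightarrow> complex fps" where
  "multi_polylog ks =
     Abs_fps (\<lambda>n. \<Sum>ms\<in>polylog_indices (length ks) n.
       1 / (\<Prod>i<length ks. of_nat (ms ! i) powi (ks ! i)))"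

text \<open>The series $u^{yt} = e^{yt\ln u}$ in $t$, for $u > 0$.\<close>

definition fps_rpow :: "real \<Rightarrow> complex \<Rightarrow> complex fps" where
  "fps_rpow u y = fps_exp (y * of_real (ln u))"

text \<open>The series $1-(ab)^{-t}$ has constant term $0$, so the composition is the formal
  substitution; $(a^{-t}+b^t)^r$ has constant term $2^r$, so the quotient is the one by a unit.\<close>

definition multi_poly_euler_gf ::
    "int list \<Rightarrow> complex \<Rightarrow> real \<Rightarrow> real \<Rightarrow> real \<Rightarrow> complex fps" where
  "multi_poly_euler_gf ks x a b c =
     2 * (multi_polylog ks oo (1 - fps_rpow (a * b) (-1)))
       / (fps_rpow a (-1) + fps_rpow b 1) ^ length ks
       * fps_rpow c (of_nat (length ks) * x)"

definition multi_poly_euler ::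
    "int list \<Rightarrow> nat \<Rightarrow> complex \<Rightarrow> real \<Rightarrow> real \<Rightarrow> real \<Rightarrow> complex" where
  "multi_poly_euler ks n x a b c = fact n * fps_nth (multi_poly_euler_gf ks x a b c) n"

lemma multi_poly_euler_gf_eq:
  "multi_poly_euler_gf ks x a b c = Abs_fps (\<lambda>n. multi_poly_euler ks n x a b c / fact n)"
  by (rule fps_ext) (simp add: multi_poly_euler_def)

definition multi_poly_euler2 ::
    "int list \<Rightarrow> nat \<Rightarrow> complex \<Rightarrow> real \<Rightarrow> real \<Rightarrow> complex" where
  "multi_poly_euler2 ks n x a b = multi_poly_euler ks n x a b (exp 1)"

end

theory Submission
  imports Defs
begin

text \<open>Put \<open>z = r * ln c\<close>. The generating function is
  \<open>h * fps_exp (z * x)\<close>, where \<open>h\<close> depends on neither \<open>x\<close> nor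
  \<open>c\<close>. Expand exp(xzt) = (1 - (1 - exp(-zt)))^(-x) by the binomial series
  (\<open>fps_binomial_compose_exp\<close>): the coefficient of (1 - exp(-zt))^m is
  \<open>pochhammer x m / fact m\<close>. Now (1 - exp(-zt))^m = (exp(zt) - 1)^m exp(-mzt). The
  first factor, divided by m!, generates the Stirling numbers
  (\<open>fps_exp_minus_1_power_nth\<close>); the second, times \<open>h\<close>, generates the
  polynomials at -m ln c with base e. Comparing coefficients of t^n gives the formula; only m \<le>
  n contribute, because 1 - exp(-zt) has no constant term.\<close>

text \<open>Differentiating (exp(zt) - 1)^m gives mz((exp(zt) - 1)^m + (exp(zt) - 1)^(m-1)), which
  is the Stirling recurrence S(l+1,m) = m S(l,m) + S(l,m-1) on coefficients.\<close>

lemma fps_exp_minus_1_power_nth: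
  fixes z :: "'a::field_char_0"
  shows "fps_nth ((fps_exp z - 1) ^ m) l = fact m * of_nat (Stirling l m) * z ^ l / fact l"
proof (induction l arbitrary: m)
  case 0
  then show ?case by (cases m) (simp_all add: fps_power_zeroth)
next
  case (Suc l)
  show ?case
  proof (cases m)
    case 0
    then show ?thesis by simp
  next
    case (Suc k)
    have "fps_deriv ((fps_exp z - 1) ^ m) =
        fps_const (of_nat m * z) * (fps_exp z * (fps_exp z - 1) ^ k)"
      by (simp add: Suc fps_deriv_power mult_ac flip: fps_const_mult del: of_nat_Suc power_Suc)
    also have "fps_exp z * (fps_exp z - 1) ^ k = (fps_exp z - 1) ^ m + (fps_exp z - 1) ^ k"
      by (simp add: Suc algebra_simps)
    finally have "fps_nth (fps_deriv ((fps_exp z - 1) ^ m)) l =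
        of_nat m * z * (fps_nth ((fps_exp z - 1) ^ m) l + fps_nth ((fps_exp z - 1) ^ k) l)"
      by simp
    then have "of_nat (Suc l) * fps_nth ((fps_exp z - 1) ^ m) (Suc l) =
        of_nat m * z * (fact m * of_nat (Stirling l m) * z ^ l / fact l
          + fact k * of_nat (Stirling l k) * z ^ l / fact l)"
      by (simp add: Suc.IH)
    also have "\<dots> = fact m * of_nat (Stirling (Suc l) m) * z ^ Suc l / fact l"
      unfolding Suc by (simp add: field_simps)
    finally show ?thesis
      by (simp add: field_simps del: of_nat_Suc Stirling.simps)
  qed
qed

text \<open>The binomial series solves (1 + X) B' = y B. Substituting exp(zt) - 1 turns 1 + X into
  exp(zt), so the chain rule yields F' = yz F, and F has constant term 1.\<close>

lemma fps_binomial_compose_exp: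
  fixes y z :: "'a::field_char_0"
  shows "fps_binomial y oo (fps_exp z - 1) = fps_exp (y * z)"
proof -
  let ?B = "fps_binomial y" and ?E = "fps_exp z"
  let ?F = "?B oo (?E - 1)"
  have "fps_deriv ?B * (1 + fps_X) = fps_const y * ?B"
    by (simp add: fps_binomial_deriv fps_divide_times_eq)
  then have "(fps_deriv ?B * (1 + fps_X)) oo (?E - 1) = fps_const y * ?F"
    by (simp add: fps_compose_mult_distrib)
  then have "(fps_deriv ?B oo (?E - 1)) * ?E = fps_const y * ?F"
    by (simp add: fps_compose_mult_distrib fps_compose_add_distrib)
  then have "fps_deriv ?F = fps_const (y * z) * ?F"
    by (simp add: fps_compose_deriv mult_ac flip: fps_const_mult)
  then show ?thesis
    by (simp add: fps_exp_unique_ODE)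
qed

text \<open>Since \<open>g ^ m\<close> starts in degree m or later, the sum for each coefficient of
  the composition can be extended to the common bound \<open>n\<close>; then the two sums are
  exchanged.\<close>

lemma fps_mult_compose_nth:
  fixes f g h :: "'a::comm_ring_1 fps"
  assumes "fps_nth g 0 = 0"
  shows "fps_nth (h * (f oo g)) n = (\<Sum>m\<le>n. fps_nth f m * fps_nth (h * g ^ m) n)"
proof -
  have "fps_nth (f oo g) i = (\<Sum>m\<le>n. fps_nth f m * fps_nth (g ^ m) i)" if "i \<le> n" for i
    unfolding fps_compose_nth
    using that assms by (intro sum.mono_neutral_left) (auto simp: startsby_zero_power_prefix)
  then have "fps_nth (h * (f oo g)) n =
      (\<Sum>i=0..n. \<Sum>m\<le>n. fps_nth h i * (fps_nth f m * fps_nth (g ^ m) (n - i)))"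
    by (simp add: fps_mult_nth sum_distrib_left)
  also have "\<dots> = (\<Sum>m\<le>n. fps_nth f m * fps_nth (h * g ^ m) n)"
    by (subst sum.swap) (simp add: fps_mult_nth sum_distrib_left mult_ac)
  finally show ?thesis .
qed

text \<open>Expands \<open>exp(xzt) = (1 - (1 - exp(-zt)))\<^sup>-\<^sup>x\<close> in powers of \<open>1 - exp(-zt) = (exp(zt) - 1) exp(-zt)\<close>.\<close>

lemma fps_mult_exp_nth_Stirling:
  fixes x z :: "'a::field_char_0"
  shows "fact n * fps_nth (h * fps_exp (z * x)) n =
    (\<Sum>m\<le>n. \<Sum>l=m..n. z ^ l * of_nat (Stirling l m) * of_nat (n choose l)
      * (fact (n - l) * fps_nth (h * fps_exp (- (of_nat m * z))) (n - l)) * pochhammer x m)"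
proof -
  have pow: "(fps_exp (- z) - 1) ^ m =
      fps_const ((-1) ^ m) * (fps_exp z - 1) ^ m * fps_exp (- (of_nat m * z))" for m
  proof -
    have "fps_exp (- z) - 1 = fps_const (-1) * (fps_exp z - 1) * fps_exp (- z)"
      by (simp add: algebra_simps flip: fps_exp_add_mult fps_const_neg)
    then show ?thesis
      by (simp add: power_mult_distrib fps_exp_power_mult fps_const_power)
  qed
  have term_eq: "fact n * (fps_nth (fps_binomial (- x)) m * fps_nth (h * (fps_exp (- z) - 1) ^ m) n) =
      (\<Sum>l=m..n. z ^ l * of_nat (Stirling l m) * of_nat (n choose l)
        * (fact (n - l) * fps_nth (h * fps_exp (- (of_nat m * z))) (n - l)) * pochhammer x m)"
    (is "?lhs = ?rhs") for m
  proof -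
    let ?g = "h * fps_exp (- (of_nat m * z))"
    have "h * (fps_exp (- z) - 1) ^ m = fps_const ((-1) ^ m) * ((fps_exp z - 1) ^ m * ?g)"
      by (simp add: pow mult_ac)
    then have "fps_nth (h * (fps_exp (- z) - 1) ^ m) n =
        (-1) ^ m * fps_nth ((fps_exp z - 1) ^ m * ?g) n"
      by (simp only: fps_mult_left_const_nth)
    \<comment> \<open>The sign cancels against the one in binom(-x, m) = (-1)^m
      \<open>pochhammer x m / fact m\<close>.\<close>
    then have "?lhs = fact n * (pochhammer x m / fact m) * fps_nth ((fps_exp z - 1) ^ m * ?g) n"
      by (simp add: gbinomial_pochhammer)
    also have "\<dots> = (\<Sum>l=0..n. fact n * (pochhammer x m / fact m)
        * (fact m * of_nat (Stirling l m) * z ^ l / fact l * fps_nth ?g (n - l)))"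
      by (simp only: fps_mult_nth[of "(fps_exp z - 1) ^ m"] fps_exp_minus_1_power_nth sum_distrib_left)
    \<comment> \<open>\<open>Stirling l m\<close> vanishes for l < m.\<close>
    also have "\<dots> = (\<Sum>l=m..n. fact n * (pochhammer x m / fact m)
        * (fact m * of_nat (Stirling l m) * z ^ l / fact l * fps_nth ?g (n - l)))"
      by (intro sum.mono_neutral_right) auto
    also have "\<dots> = ?rhs"
      by (intro sum.cong) (auto simp: binomial_fact)
    finally show ?thesis .
  qed
  have "fps_exp (z * x) = fps_binomial (- x) oo (fps_exp (- z) - 1)"
    by (simp add: fps_binomial_compose_exp mult.commute)
  then have "fact n * fps_nth (h * fps_exp (z * x)) n =
      (\<Sum>m\<le>n. fact n * (fps_nth (fps_binomial (- x)) m * fps_nth (h * (fps_exp (- z) - 1) ^ m) n))"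
    by (simp add: fps_mult_compose_nth sum_distrib_left)
  then show ?thesis
    by (simp only: term_eq)
qed

theorem theorem2p2:
  fixes r n :: nat and ks :: "int list" and a b c :: real and x :: complex
  assumes "r \<ge> 1" and "length ks = r"
    and "a > 0" and "b > 0" and "c > 0"
  shows "(\<lambda>m. \<Sum>l=m..n. of_real ((real r * ln c) ^ l) * of_nat (Stirling l m)
            * of_nat (n choose l) * multi_poly_euler2 ks (n - l) (of_real (- real m * ln c)) a b
            * pochhammer x m)
         sums multi_poly_euler ks n x a b c"
proof -
  let ?f = "\<lambda>m. \<Sum>l=m..n. of_real ((real r * ln c) ^ l) * of_nat (Stirling l m)
            * of_nat (n choose l) * multi_poly_euler2 ks (n - l) (of_real (- real m * ln c)) a b
            * pochhammer x m"
  define z :: complex where "z = of_nat r * of_real (ln c)"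
  define h where "h = 2 * (multi_polylog ks oo (1 - fps_rpow (a * b) (-1)))
       / (fps_rpow a (-1) + fps_rpow b 1) ^ length ks"
  have gf: "multi_poly_euler ks n x a b c = fact n * fps_nth (h * fps_exp (z * x)) n"
    using assms(2)
    by (simp add: multi_poly_euler_def multi_poly_euler_gf_def h_def z_def fps_rpow_def mult_ac)
  \<comment> \<open>As ln e = 1, the argument -m ln c produces the exponent r(-m ln c) =
    -mz.\<close>
  have gf2: "multi_poly_euler2 ks j (of_real (- real m * ln c)) a b =
      fact j * fps_nth (h * fps_exp (- (of_nat m * z))) j" for m j
    using assms(2)
    by (simp add: multi_poly_euler2_def multi_poly_euler_def multi_poly_euler_gf_def h_def z_def
        fps_rpow_def mult_ac)
  \<comment> \<open>For m > n the range \<open>m..n\<close> is empty, so the series is a finite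
    sum.\<close>
  have "?f sums (\<Sum>m\<le>n. ?f m)"
    by (rule sums_finite) auto
  also have "(\<Sum>m\<le>n. ?f m) = multi_poly_euler ks n x a b c"
    unfolding gf gf2 fps_mult_exp_nth_Stirling by (simp add: z_def)
  finally show ?thesis .
qed

end
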